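(* Let $\mathcal{A}: B_\delta^m(0) \to \mathrm{GL}(\mathbb{R}^n)$ be a given real analytic map. The following two statements are equivalent. (1) There exists a (real analytic) function $\mathcal{W}: B_\delta^m(0) \to \mathrm{GL}(\mathbb{R}^n)$ such that $$DG(P(\sigma))\,\mathcal{W}(\sigma) = D\mathcal{W}(\sigma)\,\Omega^{\mathrm{s}}\sigma + \mathcal{W}(\sigma)\mathcal{A}(\sigma)$$ for all $\sigma \in B_\delta^m(0)$. (2) There exists a (real analytic) function $\mathcal{W}: B_\delta^m(0) \to \mathrm{GL}(\mathbb{R}^n)$ such that, for every $\sigma \in B^m_\delta(0)$: if $\tilde M(x) \in \mathbb{R}^{n\times n}$ satisfies $$\tilde M'(x) = \mathcal{A}(e^{\Omega^{\mathrm{s}} x}\sigma)\tilde M(x), \qquad \tilde M(0) = I$$ for all $x \ge 0$, then $M(x) = \mathcal{W}(e^{\Omega^{\mathrm{s}} x}\sigma)\tilde M(x)$ solves $$M'(x) = DG(P(e^{\Omega^{\mathrm{s}} x}\sigma))M(x), \qquad M(0) = \mathcal{W}(\sigma)$$ for $x \geq 0$.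
   Context: $G:\mathbb{R}^n\to\mathbb{R}^n$ is a real analytic vector field with a hyperbolic equilibrium $U_*$ such that $DG(U_* )$ is diagonalizable with real eigenvalues $\mu_1<\dots<\mu_m<0<\mu_{m+1}<\dots<\mu_n$ and corresponding eigenvectors $\hat V_1,\dots,\hat V_n$. Set $\Omega^{\mathrm{s}}=\mathrm{diag}(\mu_1,\dots,\mu_m)$. For $\delta>0$, $B_\delta^m(0)=[-\delta,\delta]^m$. Let $\Phi(x;U)$ denote the flow of $U'=G(U)$. $P:B_\delta^m(0)\to\mathbb{R}^n$ is an (analytic) parameterization of the local stable manifold of $U_*$ conjugating to the linear flow: $P(0)=U_*$, $DP(0)=[\hat V_1|\cdots|\hat V_m]$, and $\Phi(x;P(\sigma))=P(e^{\Omega^{\mathrm{s}}x}\sigma)$ for all $\sigma\in B_\delta^m(0)$, $x\ge 0$. $\mathrm{GL}(\mathbb{R}^n)$ is the group of real invertible $n\times n$ matrices. $D\mathcal{W}(\sigma)\,\Omega^{\mathrm{s}}\sigma$ denotes the derivative of the matrix-valued map $\mathcal{W}$ at $\sigma$ in the direction $\Omega^{\mathrm{s}}\sigma\in\mathbb{R}^m$, which is an $n\times n$ matrix. *)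

theory Defs
  imports "HOL-Analysis.Analysis"
begin

text \<open>
  Real analyticity on a set \<open>S\<close> that need not be open: around every point of \<open>S\<close>, the function
  agrees on \<open>S\<close> with the sum of a multivariate power series convergent on a full ball.
  A coefficient is indexed by its multi-index \<open>\<alpha>\<close>; the values of \<open>f\<close> outside \<open>S\<close> are irrelevant.
\<close>

definition real_analytic_on ::
    "(real ^ 'm \<Rightarrow> 'b::real_normed_vector) \<Rightarrow> (real ^ 'm) set \<Rightarrow> bool"
    (infixl \<open>real'_analytic'_on\<close> 50) where
  "f real_analytic_on S \<longleftrightarrow>
     (\<forall>a\<in>S. \<exists>r>0. \<exists>(c :: ('m \<Rightarrow> nat) \<Rightarrow> 'b) g.
        (\<forall>x\<in>ball a r. ((\<lambda>\<alpha>. (\<Prod>i\<in>UNIV. (x $ i - a $ i) ^ \<alpha> i) *\<^sub>R c \<alpha>) has_sum g x) UNIV) \<and>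
        (\<forall>x\<in>S \<inter> ball a r. f x = g x))"

definition cube :: "real \<Rightarrow> (real ^ 'm) set" where
  "cube \<delta> = cbox (\<chi> i. - \<delta>) (\<chi> i. \<delta>)"

definition diag_mat :: "('m \<Rightarrow> real) \<Rightarrow> real ^ 'm ^ 'm" where
  "diag_mat d = (\<chi> i j. if i = j then d i else 0)"

definition mat_exp :: "real ^ 'm ^ 'm \<Rightarrow> real ^ 'm ^ 'm" where
  "mat_exp A = (\<Sum>k. (1 / fact k) *\<^sub>R (((**) A ^^ k) (mat 1)))"

text \<open>
  \<open>solves_ivp G U T u\<close>: the curve \<open>u\<close> is a solution of \<open>u' = G(u)\<close>, \<open>u(0) = U\<close> on the
  interval \<open>T\<close> (one-sided derivatives at end points).  The flow is a partial map; \<open>flow G x U\<close> is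
  meaningful when the solution through \<open>U\<close> exists on the whole interval between \<open>0\<close> and \<open>x\<close>.
\<close>

definition solves_ivp ::
    "(real ^ 'n \<Rightarrow> real ^ 'n) \<Rightarrow> real ^ 'n \<Rightarrow> real set \<Rightarrow> (real \<Rightarrow> real ^ 'n) \<Rightarrow> bool" where
  "solves_ivp G U T u \<longleftrightarrow>
     u 0 = U \<and> (\<forall>t\<in>T. (u has_vector_derivative G (u t)) (at t within T))"

definition flow_defined :: "(real ^ 'n \<Rightarrow> real ^ 'n) \<Rightarrow> real \<Rightarrow> real ^ 'n \<Rightarrow> bool" where
  "flow_defined G x U \<longleftrightarrow> (\<exists>u. solves_ivp G U (closed_segment 0 x) u)"

definition flow :: "(real ^ 'n \<Rightarrow> real ^ 'n) \<Rightarrow> real \<Rightarrow> real ^ 'n \<Rightarrow> real ^ 'n" where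
  "flow G x U = (THE y. \<exists>u. solves_ivp G U (closed_segment 0 x) u \<and> u x = y)"

definition stable_set :: "(real ^ 'n \<Rightarrow> real ^ 'n) \<Rightarrow> real ^ 'n \<Rightarrow> (real ^ 'n) set" where
  "stable_set G U\<^sub>0 =
     {U. (\<forall>x\<ge>0. flow_defined G x U) \<and> ((\<lambda>x. flow G x U) \<longlongrightarrow> U\<^sub>0) at_top}"

text \<open>
  A local stable manifold of \<open>U\<^sub>0\<close> is a part of the stable set containing all points whose forward
  orbit stays in some neighbourhood \<open>N\<close> of \<open>U\<^sub>0\<close> and converges to \<open>U\<^sub>0\<close>.
\<close>

definition local_stable_manifold ::
    "(real ^ 'n \<Rightarrow> real ^ 'n) \<Rightarrow> real ^ 'n \<Rightarrow> (real ^ 'n) set \<Rightarrow> bool" where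
  "local_stable_manifold G U\<^sub>0 S \<longleftrightarrow>
     S \<subseteq> stable_set G U\<^sub>0 \<and>
     (\<exists>N. open N \<and> U\<^sub>0 \<in> N \<and> {U \<in> stable_set G U\<^sub>0. \<forall>x\<ge>0. flow G x U \<in> N} \<subseteq> S)"

lemma diag_mat_pow: "((**) (diag_mat d) ^^ k) (mat 1) = diag_mat (\<lambda>i. d i ^ k)"
proof (induction k)
  case 0
  show ?case by (simp add: diag_mat_def mat_def vec_eq_iff)
next
  case (Suc k)
  have "(diag_mat d ** diag_mat (\<lambda>i. d i ^ k)) $ i $ j = diag_mat (\<lambda>i. d i ^ Suc k) $ i $ j" for i j
  proof -
    have "(diag_mat d ** diag_mat (\<lambda>i. d i ^ k)) $ i $ j
        = (\<Sum>l\<in>UNIV. if i = l then (if l = j then d i * d l ^ k else 0) else 0)"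
      unfolding matrix_matrix_mult_def diag_mat_def vec_lambda_beta by (rule sum.cong) auto
    also have "\<dots> = (if i = j then d i * d i ^ k else 0)"
      by (subst sum.delta') auto
    finally show ?thesis by (simp add: diag_mat_def)
  qed
  then have "diag_mat d ** diag_mat (\<lambda>i. d i ^ k) = diag_mat (\<lambda>i. d i ^ Suc k)"
    unfolding vec_eq_iff by blast
  then show ?case using Suc by simp
qed

lemma mat_exp_diag_mat: "mat_exp (diag_mat d) = diag_mat (\<lambda>i. exp (d i))"
proof -
  have ent: "((1 / fact k) *\<^sub>R (((**) (diag_mat d) ^^ k) (mat 1))) $ i $ j
      = (if i = j then d i ^ k /\<^sub>R fact k else 0)" for k i j
    unfolding diag_mat_pow by (simp add: diag_mat_def divide_inverse)
  have e: "(\<lambda>k. ((1 / fact k) *\<^sub>R (((**) (diag_mat d) ^^ k) (mat 1))) $ i $ j)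
      sums (diag_mat (\<lambda>i. exp (d i)) $ i $ j)" for i j
    unfolding ent using exp_converges[of "d i"] by (cases "i = j") (simp_all add: diag_mat_def)
  have "(\<lambda>k. (1 / fact k) *\<^sub>R (((**) (diag_mat d) ^^ k) (mat 1)))
      sums diag_mat (\<lambda>i. exp (d i))"
    unfolding sums_def using e unfolding sums_def
    by (intro vec_tendstoI) (simp only: sum_component)
  then show ?thesis unfolding mat_exp_def by (rule sums_unique[symmetric])
qed

end

theory Submission
  imports Defs
begin

text \<open>
  The curve \<open>x \<mapsto> e\<^bsup>\<Omega>x\<^esup>\<sigma>\<close> is the flow of \<open>\<sigma>' = \<Omega>\<sigma>\<close>, so the product rule gives
  \<open>M' = (DW \<Omega>\<sigma> + W A) Mt\<close> along it. Hence the identity in (1) yields the differential equation in (2);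
  conversely, evaluating that equation at \<open>x = 0\<close>, where \<open>Mt = I\<close>, returns the identity pointwise.
  The converse needs a solution \<open>Mt\<close> to exist on \<open>[0, \<infinity>)\<close>, as otherwise (2) is vacuous; it is obtained
  from the Picard series.
\<close>

section \<open>Differentiability of real analytic functions on sets that need not be open\<close>

text \<open>Absolute convergence at the diagonal point \<open>a + (\<rho>, ..., \<rho>)\<close>
  bounds the weighted coefficients. Near \<open>a\<close>, every monomial of degree at least two is
  at most \<open>(norm (x - a) / \<rho>)^2\<close> times its value at that point, so the tail is
  quadratically small.\<close>

lemma power_series_quadratic_remainder:
  fixes c :: "('m::finite \<Rightarrow> nat) \<Rightarrow> real" and g :: "real ^ 'm \<Rightarrow> real"
  assumes r: "r > 0"
    and g: "\<And>x. x \<in> ball a r \<Longrightarrow> ((\<lambda>\<alpha>. (\<Prod>i\<in>UNIV. (x $ i - a $ i) ^ \<alpha> i) * c \<alpha>) has_sum g x) UNIV"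
  shows "\<exists>\<rho> C u. 0 < \<rho> \<and> \<rho> < r \<and> (\<forall>x. norm (x - a) \<le> \<rho> \<longrightarrow>
       \<bar>g x - c (\<lambda>_. 0) - (\<Sum>i\<in>UNIV. (x $ i - a $ i) * u i)\<bar> \<le> C * (norm (x - a))\<^sup>2)"
proof -
  \<comment> \<open>Chosen so that the vector with all entries \<open>\<rho>\<close> has l1 norm
    \<open>r / 2\<close>, which puts the diagonal point \<open>y\<close> inside the ball.\<close>
  define \<rho> where "\<rho> = r / (2 * real CARD('m))"
  have card: "real CARD('m) \<ge> 1" by (simp add: Suc_leI)
  have \<rho>: "0 < \<rho>" using r card by (simp add: \<rho>_def)
  have "\<rho> \<le> r / 2"
    using r card by (simp add: \<rho>_def field_simps)
  then have \<rho>r: "\<rho> < r" using r by linarith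
  define y where "y = a + (\<chi> i. \<rho>)"
  have "norm ((\<chi> i. \<rho>) :: real ^ 'm) \<le> (\<Sum>i\<in>(UNIV::'m set). \<bar>\<rho>\<bar>)"
    using norm_le_l1_cart[of "(\<chi> i. \<rho>) :: real ^ 'm"] by simp
  also have "\<dots> = r / 2" using r by (simp add: \<rho>_def)
  finally have "y \<in> ball a r" using r by (simp add: y_def dist_norm abs_of_pos)
  \<comment> \<open>For real families, unconditional summability is absolute summability. At
    \<open>y\<close> the monomial of index \<alpha> is \<rho> to the total degree of
    \<alpha>.\<close>
  from has_sum_imp_summable[OF g[OF this], THEN iffD1[OF summable_on_iff_abs_summable_on_real]]
  have "(\<lambda>\<alpha>. norm (\<rho> ^ sum \<alpha> UNIV * c \<alpha>)) summable_on UNIV"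
    by (simp add: y_def power_sum)
  then have abs: "(\<lambda>\<alpha>. \<rho> ^ sum \<alpha> UNIV * \<bar>c \<alpha>\<bar>) summable_on UNIV"
    using \<rho> by (simp add: abs_mult)
  define K where "K = infsum (\<lambda>\<alpha>. \<rho> ^ sum \<alpha> UNIV * \<bar>c \<alpha>\<bar>) UNIV"
  have K: "((\<lambda>\<alpha>. \<rho> ^ sum \<alpha> UNIV * \<bar>c \<alpha>\<bar>) has_sum K) UNIV"
    using abs by (simp add: K_def)
  define unit where "unit i = (\<lambda>j::'m. if j = i then 1 else 0 :: nat)" for i
  \<comment> \<open>The multi-indices of total degree at most one, that is, the affine part of the
    series.\<close>
  define B where "B = insert (\<lambda>_. 0) (range unit)"
  have inj: "inj unit"
  proof (rule injI)
    fix i j assume "unit i = unit j"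
    then have "unit i i = unit j i" by simp
    then show "i = j" by (simp add: unit_def split: if_splits)
  qed
  have nz: "(\<lambda>_. 0) \<notin> range unit"
  proof
    assume "(\<lambda>_. 0) \<in> range unit"
    then obtain i where "unit i = (\<lambda>_. 0)" by auto
    from fun_cong[OF this, of i] show False by (simp add: unit_def)
  qed
  have high: "sum \<alpha> UNIV \<ge> 2" if "\<alpha> \<notin> B" for \<alpha>
  proof (rule ccontr)
    assume "\<not> ?thesis"
    then consider "sum \<alpha> UNIV = 0" | "sum \<alpha> UNIV = Suc 0" by linarith
    then show False
    proof cases
      case 1
      then have "\<alpha> = (\<lambda>_. 0)" by auto
      then show False using that by (simp add: B_def)
    next
      case 2
      then obtain i where "\<alpha> i = Suc 0" "\<forall>j. i \<noteq> j \<longrightarrow> \<alpha> j = 0"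
        by (auto simp: sum_eq_Suc0_iff)
      then have "\<alpha> = unit i" by (auto simp: unit_def)
      then show False using that by (simp add: B_def)
    qed
  qed
  have main: "\<bar>g x - c (\<lambda>_. 0) - (\<Sum>i\<in>UNIV. (x $ i - a $ i) * c (unit i))\<bar> \<le> K / \<rho>\<^sup>2 * (norm (x - a))\<^sup>2"
    if x: "norm (x - a) \<le> \<rho>" for x
  proof -
    define t where "t \<alpha> = (\<Prod>i\<in>UNIV. (x $ i - a $ i) ^ \<alpha> i) * c \<alpha>" for \<alpha>
    define s where "s = norm (x - a)"
    have "x \<in> ball a r" using x \<rho>r by (simp add: dist_norm norm_minus_commute)
    then have t: "(t has_sum g x) UNIV" unfolding t_def by (rule g)
    have t0: "t (\<lambda>_. 0) = c (\<lambda>_. 0)" by (simp add: t_def)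
    have t1: "t (unit i) = (x $ i - a $ i) * c (unit i)" for i
    proof -
      have "(\<Prod>j\<in>UNIV. (x $ j - a $ j) ^ unit i j) = (\<Prod>j\<in>UNIV. if j = i then x $ j - a $ j else 1)"
        by (rule prod.cong) (auto simp: unit_def)
      then show ?thesis by (simp add: t_def)
    qed
    have "sum t B = c (\<lambda>_. 0) + (\<Sum>i\<in>UNIV. (x $ i - a $ i) * c (unit i))"
      unfolding B_def using nz by (simp add: t0 sum.reindex[OF inj] t1 o_def)
    \<comment> \<open>The affine part is written as a family over all multi-indices that vanishes
      off \<open>B\<close>, so that it can be subtracted from \<open>t\<close> term by term.\<close>
    then have low: "((\<lambda>\<alpha>. if \<alpha> \<in> B then t \<alpha> else 0) has_sum
        (c (\<lambda>_. 0) + (\<Sum>i\<in>UNIV. (x $ i - a $ i) * c (unit i)))) UNIV"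
      by (intro has_sum_finite_neutralI[of B]) (auto simp: B_def)
    have "((\<lambda>\<alpha>. - (if \<alpha> \<in> B then t \<alpha> else 0)) has_sum
        - (c (\<lambda>_. 0) + (\<Sum>i\<in>UNIV. (x $ i - a $ i) * c (unit i)))) UNIV"
      by (rule iffD2[OF has_sum_uminus]) (simp only: minus_minus low)
    from has_sum_add[OF t this]
    have rest: "((\<lambda>\<alpha>. t \<alpha> - (if \<alpha> \<in> B then t \<alpha> else 0)) has_sum
        (g x - (c (\<lambda>_. 0) + (\<Sum>i\<in>UNIV. (x $ i - a $ i) * c (unit i))))) UNIV"
      by (simp only: diff_conv_add_uminus)
    have bound: "\<bar>t \<alpha>\<bar> \<le> (s / \<rho>)\<^sup>2 * (\<rho> ^ sum \<alpha> UNIV * \<bar>c \<alpha>\<bar>)" if \<alpha>: "\<alpha> \<notin> B" for \<alpha>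
    proof -
      \<comment> \<open>Of the \<open>2 + k\<close> factors, each at most \<open>s\<close>, two are
        kept to give the square; the other \<open>k\<close> are enlarged to \<rho>.\<close>
      obtain k where k: "sum \<alpha> UNIV = 2 + k" using high[OF \<alpha>] le_Suc_ex by blast
      have "\<bar>\<Prod>i\<in>UNIV. (x $ i - a $ i) ^ \<alpha> i\<bar> = (\<Prod>i\<in>UNIV. \<bar>x $ i - a $ i\<bar> ^ \<alpha> i)"
        by (simp add: abs_prod power_abs)
      also have "\<dots> \<le> (\<Prod>i\<in>UNIV. s ^ \<alpha> i)"
        using component_le_norm_cart[of "x - a"]
        by (intro prod_mono conjI power_mono) (auto simp: s_def)
      also have "\<dots> = s\<^sup>2 * s ^ k" unfolding power_sum[symmetric] k power_add ..
      also have "\<dots> \<le> s\<^sup>2 * \<rho> ^ k"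
        using x by (intro mult_left_mono power_mono) (auto simp: s_def)
      also have "\<dots> = (s / \<rho>)\<^sup>2 * \<rho> ^ sum \<alpha> UNIV"
        using \<rho> by (simp add: k power_add power_divide power2_eq_square)
      finally show ?thesis
        unfolding t_def abs_mult mult.assoc[symmetric] by (rule mult_right_mono) simp
    qed
    have "norm (g x - (c (\<lambda>_. 0) + (\<Sum>i\<in>UNIV. (x $ i - a $ i) * c (unit i)))) \<le> (s / \<rho>)\<^sup>2 * K"
      using rest
    proof (rule norm_infsum_le[OF _ has_sum_cmult_right[OF K]])
      fix \<alpha>
      show "norm (t \<alpha> - (if \<alpha> \<in> B then t \<alpha> else 0)) \<le> (s / \<rho>)\<^sup>2 * (\<rho> ^ sum \<alpha> UNIV * \<bar>c \<alpha>\<bar>)"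
        using bound[of \<alpha>] \<rho> by simp
    qed
    then show ?thesis by (simp add: s_def power_divide field_simps)
  qed
  show ?thesis
    by (intro exI[of _ \<rho>] exI[of _ "K / \<rho>\<^sup>2"] exI[of _ "\<lambda>i. c (unit i)"]
        conjI allI impI \<rho> \<rho>r main)
qed

text \<open>
  Only the derivative at the centre of a power series is needed, since the definition of analyticity
  provides an expansion around every point.
\<close>

lemma differentiable_within_if_power_series:
  fixes c :: "('m::finite \<Rightarrow> nat) \<Rightarrow> real" and f g :: "real ^ 'm \<Rightarrow> real"
  assumes r: "r > 0" and a: "a \<in> S"
    and g: "\<And>x. x \<in> ball a r \<Longrightarrow> ((\<lambda>\<alpha>. (\<Prod>i\<in>UNIV. (x $ i - a $ i) ^ \<alpha> i) * c \<alpha>) has_sum g x) UNIV"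
    and f: "\<And>x. x \<in> S \<inter> ball a r \<Longrightarrow> f x = g x"
  shows "f differentiable at a within S"
proof -
  obtain \<rho> C u where \<rho>: "0 < \<rho>" "\<rho> < r" and
    rem': "\<forall>x. norm (x - a) \<le> \<rho> \<longrightarrow>
       \<bar>g x - c (\<lambda>_. 0) - (\<Sum>i\<in>UNIV. (x $ i - a $ i) * u i)\<bar> \<le> C * (norm (x - a))\<^sup>2"
    using power_series_quadratic_remainder[where c = c and g = g, OF r g] by blast
  note rem = rem'[rule_format]
  have ga: "g a = c (\<lambda>_. 0)" using rem[of a] \<rho> by simp
  have "(f has_derivative (\<lambda>h. \<Sum>i\<in>UNIV. h $ i * u i)) (at a within S)"
    unfolding has_derivative_within_alt
  proof (intro conjI allI impI)
    show "bounded_linear (\<lambda>h. \<Sum>i\<in>UNIV. h $ i * u i)"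
      by (intro bounded_linear_sum bounded_linear_mult_const bounded_linear_vec_nth)
  next
    fix e :: real assume e: "0 < e"
    \<comment> \<open>The second bound turns the quadratic remainder into
      \<open>e * norm (y - a)\<close>; adding 1 to \<open>\<bar>C\<bar>\<close> keeps the divisor
      positive.\<close>
    define d where "d = min \<rho> (e / (\<bar>C\<bar> + 1))"
    have "norm (f y - f a - (\<Sum>i\<in>UNIV. (y - a) $ i * u i)) \<le> e * norm (y - a)"
      if y: "y \<in> S" "norm (y - a) < d" for y
    proof -
      have y': "norm (y - a) \<le> \<rho>" and y2: "norm (y - a) \<le> e / (\<bar>C\<bar> + 1)"
        using y by (auto simp: d_def)
      have "y \<in> ball a r" "a \<in> ball a r"
        using y' \<rho> by (auto simp: dist_norm norm_minus_commute)
      then have fy: "f y = g y" "f a = g a"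
        using y(1) a by (auto intro: f)
      have "norm (f y - f a - (\<Sum>i\<in>UNIV. (y - a) $ i * u i)) \<le> C * (norm (y - a))\<^sup>2"
        using rem[OF y'] by (simp add: fy ga)
      also have "\<dots> \<le> (\<bar>C\<bar> + 1) * (norm (y - a))\<^sup>2" by (intro mult_right_mono) auto
      also have "\<dots> = ((\<bar>C\<bar> + 1) * norm (y - a)) * norm (y - a)" by (simp add: power2_eq_square)
      also have "\<dots> \<le> e * norm (y - a)"
        using y2 by (intro mult_right_mono) (auto simp: field_simps)
      finally show ?thesis .
    qed
    moreover have "d > 0" using \<rho> e by (simp add: d_def)
    ultimately show "\<exists>d>0. \<forall>y\<in>S. norm (y - a) < d \<longrightarrow>
        norm (f y - f a - (\<Sum>i\<in>UNIV. (y - a) $ i * u i)) \<le> e * norm (y - a)" by blast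
  qed
  then show ?thesis by (rule differentiableI)
qed

text \<open>Taking inner products with basis vectors commutes with summation, so each coordinate is
  again a power series, now with real coefficients. This supplies the derivative of \<open>W\<close>
  and the continuity of \<open>A\<close> on the closed cube.\<close>

lemma real_analytic_on_imp_differentiable_on:
  fixes f :: "real ^ 'm::finite \<Rightarrow> 'b::euclidean_space"
  assumes "f real_analytic_on S"
  shows "f differentiable_on S"
  unfolding differentiable_on_def
proof
  fix a assume a: "a \<in> S"
  from assms a obtain r where r: "r > 0" and "\<exists>(c :: ('m \<Rightarrow> nat) \<Rightarrow> 'b) g.
      (\<forall>x\<in>ball a r. ((\<lambda>\<alpha>. (\<Prod>i\<in>UNIV. (x $ i - a $ i) ^ \<alpha> i) *\<^sub>R c \<alpha>) has_sum g x) UNIV) \<and>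
      (\<forall>x\<in>S \<inter> ball a r. f x = g x)"
    unfolding real_analytic_on_def by blast
  then obtain c :: "('m \<Rightarrow> nat) \<Rightarrow> 'b" and g where
    g: "\<forall>x\<in>ball a r. ((\<lambda>\<alpha>. (\<Prod>i\<in>UNIV. (x $ i - a $ i) ^ \<alpha> i) *\<^sub>R c \<alpha>) has_sum g x) UNIV"
    and f: "\<forall>x\<in>S \<inter> ball a r. f x = g x"
    by blast
  show "f differentiable at a within S"
  proof (rule iffD2[OF differentiable_componentwise_within], rule ballI)
    fix b :: 'b assume "b \<in> Basis"
    show "(\<lambda>x. f x \<bullet> b) differentiable at a within S"
    proof (rule differentiable_within_if_power_series[OF r a,
          where c = "\<lambda>\<alpha>. c \<alpha> \<bullet> b" and g = "\<lambda>x. g x \<bullet> b"])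
      show "((\<lambda>\<alpha>. (\<Prod>i\<in>UNIV. (x $ i - a $ i) ^ \<alpha> i) * (c \<alpha> \<bullet> b)) has_sum g x \<bullet> b) UNIV"
        if "x \<in> ball a r" for x
        using has_sum_bounded_linear[OF bounded_linear_inner_left bspec[OF g that]] by simp
      show "f x \<bullet> b = g x \<bullet> b" if "x \<in> S \<inter> ball a r" for x
        using bspec[OF f that] by simp
    qed
  qed
qed

section \<open>Global solutions of linear differential equations\<close>

text \<open>The Picard series is dominated on each \<open>{0..N}\<close> by an exponential series
  and can be differentiated term by term. Its terms do not depend on \<open>N\<close>, so one
  function solves the equation on the whole half-line.\<close>

lemma linear_ode_global_solution:
  fixes prod :: "'a::real_normed_vector \<Rightarrow> 'b::banach \<Rightarrow> 'b" and B :: "real \<Rightarrow> 'a"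
  assumes "bounded_bilinear prod" and B: "continuous_on {0..} B"
  obtains u where "u 0 = u\<^sub>0"
    "\<And>x. x \<ge> 0 \<Longrightarrow> (u has_vector_derivative prod (B x) (u x)) (at x within {0..})"
proof -
  interpret bounded_bilinear prod by fact
  \<comment> \<open>These are the differences of successive Picard iterates; the iterates themselves
    are the partial sums.\<close>
  define T where "T = rec_nat (\<lambda>_. u\<^sub>0) (\<lambda>k f x. integral {0..x} (\<lambda>t. prod (B t) (f t)))"
  have T0: "T 0 x = u\<^sub>0" and TS: "T (Suc k) x = integral {0..x} (\<lambda>t. prod (B t) (T k t))" for k x
    by (simp_all add: T_def)
  have BN: "continuous_on {0..N} B" for N
    using B by (rule continuous_on_subset) auto
  have T_deriv': "(T (Suc k) has_vector_derivative prod (B x) (T k x)) (at x within {0..N})"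
    if "x \<in> {0..N}" "continuous_on {0..N} (T k)" for k x N
    unfolding TS
    by (rule integral_has_vector_derivative[OF continuous_on[OF BN that(2)] that(1)])
  have T_cont: "continuous_on {0..N} (T k)" for k N
  proof (induction k)
    case 0
    show ?case by (simp add: T0)
  next
    case (Suc k)
    show ?case by (rule continuous_on_vector_derivative) (rule T_deriv'[OF _ Suc])
  qed
  note T_deriv = T_deriv'[OF _ T_cont]
  define u where "u x = (\<Sum>k. T k x)" for x
  \<comment> \<open>The bound on \<open>B\<close> is available only on compact intervals, so the
    derivative is first taken within \<open>{0..N}\<close>.\<close>
  have u_deriv: "(u has_vector_derivative prod (B x) (u x)) (at x within {0..N})"
    if x: "x \<in> {0..N}" for x N
  proof -
    have "bounded (B ` {0..N})"
      by (intro compact_imp_bounded compact_continuous_image BN) simp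
    then obtain b where b: "\<And>t. t \<in> {0..N} \<Longrightarrow> norm (B t) \<le> b"
      unfolding bounded_iff by blast
    obtain K where K: "0 \<le> K" "\<And>a v. norm (prod a v) \<le> norm a * norm v * K"
      using nonneg_bounded by blast
    define L where "L = \<bar>b\<bar> * K"
    have L0: "0 \<le> L" using K by (simp add: L_def)
    have L: "norm (prod (B t) v) \<le> L * norm v" if "t \<in> {0..N}" for t v
    proof -
      have "norm (prod (B t) v) \<le> norm (B t) * norm v * K" by (rule K)
      also have "\<dots> \<le> \<bar>b\<bar> * norm v * K"
        using b[OF that] K by (intro mult_right_mono) auto
      finally show ?thesis by (simp add: L_def mult_ac)
    qed
    have T_bound: "norm (T k t) \<le> norm u\<^sub>0 * ((L * t) ^ k / fact k)" if "t \<in> {0..N}" for k t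
      using that
    proof (induction k arbitrary: t)
      case 0
      show ?case by (simp add: T0)
    next
      case (Suc k)
      \<comment> \<open>\<open>?f\<close> is \<open>L\<close> times the bound for
        \<open>T k\<close>, and \<open>?F\<close> is its antiderivative vanishing at 0, which is the
        bound for \<open>T (Suc k)\<close>.\<close>
      let ?F = "\<lambda>s. norm u\<^sub>0 * ((L * s) ^ Suc k / fact (Suc k))"
      let ?f = "\<lambda>s. L * (norm u\<^sub>0 * ((L * s) ^ k / fact k))"
      have "(?F has_vector_derivative ?f s) (at s within {0..t})" for s
      proof -
        have "(?F has_real_derivative norm u\<^sub>0 * ((real (Suc k) * (L * s) ^ k * L) / fact (Suc k)))
            (at s within {0..t})"
          by (auto intro!: derivative_eq_intros simp del: power_Suc fact_Suc of_nat_Suc)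
        also have "norm u\<^sub>0 * ((real (Suc k) * (L * s) ^ k * L) / fact (Suc k)) = ?f s"
          by (simp add: divide_simps del: of_nat_Suc)
        finally show ?thesis by (simp add: has_real_derivative_iff_has_vector_derivative)
      qed
      then have F: "(?f has_integral ?F t - ?F 0) {0..t}"
        using Suc.prems by (intro fundamental_theorem_of_calculus) auto
      have "norm (T (Suc k) t) \<le> integral {0..t} ?f"
        unfolding TS
      proof (rule integral_norm_bound_integral)
        show "(\<lambda>s. prod (B s) (T k s)) integrable_on {0..t}"
          by (intro integrable_continuous_real continuous_on BN T_cont)
        show "?f integrable_on {0..t}" using F by blast
        fix s assume "s \<in> {0..t}"
        then have s: "s \<in> {0..N}" using Suc.prems by auto
        show "norm (prod (B s) (T k s)) \<le> ?f s"
          using order_trans[OF L[OF s] mult_left_mono[OF Suc.IH[OF s] L0]] .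
      qed
      also have "\<dots> = ?F t" unfolding integral_unique[OF F] by simp
      finally show ?case .
    qed
    have majorant: "norm (T k t) \<le> norm u\<^sub>0 * ((L * N) ^ k / fact k)" if "t \<in> {0..N}" for k t
      using that L0
      by (intro order_trans[OF T_bound[OF that]] mult_left_mono divide_right_mono power_mono) auto
    have "summable (\<lambda>k. norm u\<^sub>0 * ((L * N) ^ k / fact k))"
      using summable_exp_generic[of "L * N"] by (intro summable_mult) (simp add: divide_inverse mult.commute)
    then have unif: "uniform_limit {0..N} (\<lambda>n t. \<Sum>k<n. T k t) u sequentially"
      unfolding u_def using majorant by (intro Weierstrass_m_test)
    have sums: "(\<lambda>k. T k t) sums u t" if "t \<in> {0..N}" for t
      unfolding sums_def using tendsto_uniform_limitI[OF unif that] .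
    \<comment> \<open>The derivative of \<open>T k\<close>. The constant term \<open>T 0\<close>
      contributes zero, so \<open>n + 1\<close> terms of \<open>D\<close> correspond to
      \<open>n\<close> terms of \<open>T\<close>.\<close>
    define D where "D k t = (case k of 0 \<Rightarrow> 0 | Suc j \<Rightarrow> prod (B t) (T j t))" for k t
    have D_sum: "(\<Sum>k<Suc n. D k t) = prod (B t) (\<Sum>k<n. T k t)" for n t
      by (simp add: D_def sum.lessThan_Suc_shift sum_right del: sum.lessThan_Suc)
    have "\<exists>g. \<forall>t\<in>{0..N}. (\<lambda>k. T k t) sums g t \<and>
        (g has_derivative (\<lambda>h. h *\<^sub>R prod (B t) (u t))) (at t within {0..N})"
    proof (rule has_derivative_series[where f' = "\<lambda>k t h. h *\<^sub>R D k t"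
          and f = T and x = x and l = "u x"])
      show "(T k has_derivative (\<lambda>h. h *\<^sub>R D k t)) (at t within {0..N})" if t: "t \<in> {0..N}" for k t
      proof (cases k)
        case 0
        have "T 0 = (\<lambda>_. u\<^sub>0)" by (simp add: fun_eq_iff T0)
        then show ?thesis by (simp add: 0 D_def)
      next
        case (Suc j)
        show ?thesis using T_deriv[OF t] by (simp add: Suc D_def has_vector_derivative_def)
      qed
      fix e :: real assume e: "e > 0"
      \<comment> \<open>Multiplication by \<open>B t\<close> enlarges the error by a factor of at
        most \<open>L\<close>; dividing by \<open>L + 1\<close> also covers
        \<open>L = 0\<close>.\<close>
      have "\<forall>\<^sub>F n in sequentially. \<forall>t\<in>{0..N}. dist (\<Sum>k<n. T k t) (u t) < e / (L + 1)"
        using e L0 by (intro uniform_limitD[OF unif]) auto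
      then have "\<forall>\<^sub>F n in sequentially. \<forall>t\<in>{0..N}. \<forall>h.
          norm ((\<Sum>k<Suc n. h *\<^sub>R D k t) - h *\<^sub>R prod (B t) (u t)) \<le> e * norm h"
      proof (rule eventually_mono, intro ballI allI)
        fix n t and h :: real
        assume t: "t \<in> {0..N}" and "\<forall>t\<in>{0..N}. dist (\<Sum>k<n. T k t) (u t) < e / (L + 1)"
        then have d: "norm ((\<Sum>k<n. T k t) - u t) \<le> e / (L + 1)" by (auto simp: dist_norm less_imp_le)
        have "norm ((\<Sum>k<Suc n. h *\<^sub>R D k t) - h *\<^sub>R prod (B t) (u t))
            = \<bar>h\<bar> * norm (prod (B t) ((\<Sum>k<n. T k t) - u t))"
          unfolding scaleR_sum_right[symmetric] D_sum
          by (simp flip: scaleR_diff_right add: diff_right)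
        also have "\<dots> \<le> \<bar>h\<bar> * (L * (e / (L + 1)))"
          using order_trans[OF L[OF t] mult_left_mono[OF d L0]] by (intro mult_left_mono) auto
        also have "\<dots> \<le> \<bar>h\<bar> * e"
          using e L0 by (intro mult_left_mono) (auto simp: field_simps)
        finally show "norm ((\<Sum>k<Suc n. h *\<^sub>R D k t) - h *\<^sub>R prod (B t) (u t)) \<le> e * norm h"
          by (simp add: mult.commute)
      qed
      then show "\<forall>\<^sub>F n in sequentially. \<forall>t\<in>{0..N}. \<forall>h.
          norm ((\<Sum>k<n. h *\<^sub>R D k t) - h *\<^sub>R prod (B t) (u t)) \<le> e * norm h"
        by (rule eventually_sequentially_Suc[THEN iffD1])
    qed (use x sums in auto)
    then obtain g where g: "\<And>t. t \<in> {0..N} \<Longrightarrow> (\<lambda>k. T k t) sums g t"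
      and gd: "(g has_derivative (\<lambda>h. h *\<^sub>R prod (B x) (u x))) (at x within {0..N})"
      using x by blast
    \<comment> \<open>Termwise differentiation only yields some limit function \<open>g\<close>;
      uniqueness of sums identifies it with \<open>u\<close> on the interval.\<close>
    have "u t = g t" if "t \<in> {0..N}" for t
      using sums_unique2[OF sums[OF that] g[OF that]] .
    then show ?thesis
      unfolding has_vector_derivative_def using has_derivative_transform[OF x _ gd] by blast
  qed
  show ?thesis
  proof (rule that)
    have "T (Suc k) 0 = 0" for k by (simp add: TS)
    then have "(\<lambda>k. T k 0) = (\<lambda>k. if k = 0 then u\<^sub>0 else 0)"
      by (auto simp: fun_eq_iff T0 gr0_conv_Suc)
    then show "u 0 = u\<^sub>0"
      unfolding u_def using sums_unique[OF sums_single[of 0 "\<lambda>_. u\<^sub>0"]] by simp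
  next
    fix x :: real assume x: "x \<ge> 0"
    \<comment> \<open>Only a neighbourhood of \<open>x\<close> matters; the right end
      \<open>x + 1\<close> keeps the derivative from becoming one-sided from the left.\<close>
    have "at x within {0..} = at x within {0..x + 1}"
      by (rule at_within_nhd[of x "{..<x + 1}"]) auto
    then show "(u has_vector_derivative prod (B x) (u x)) (at x within {0..})"
      using u_deriv[of x "x + 1"] x by simp
  qed
qed

section \<open>Matrix products, the diagonal linear flow and differentiation along curves\<close>

lemma bounded_bilinear_matrix_matrix_mult:
  "bounded_bilinear ((**) :: real ^ 'n ^ 'm \<Rightarrow> real ^ 'p ^ 'n \<Rightarrow> real ^ 'p ^ 'm)"
  unfolding bilinear_conv_bounded_bilinear[symmetric] bilinear_def linear_iff
  by (simp add: vec_eq_iff matrix_matrix_mult_def algebra_simps sum.distrib sum_distrib_left)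

lemma mat_exp_diag_mat_mult_vec:
  "mat_exp (x *\<^sub>R diag_mat d) *v \<sigma> = (\<chi> i. exp (x * d i) * \<sigma> $ i)"
proof -
  have "x *\<^sub>R diag_mat d = diag_mat (\<lambda>i. x * d i)"
    by (simp add: diag_mat_def vec_eq_iff)
  then have "mat_exp (x *\<^sub>R diag_mat d) = diag_mat (\<lambda>i. exp (x * d i))"
    by (simp add: mat_exp_diag_mat)
  then show ?thesis
    by (simp add: vec_eq_iff matrix_vector_mult_def diag_mat_def
        if_distrib[of "\<lambda>y. y * _"] cong: if_cong)
qed

lemma has_vector_derivative_mat_exp_diag_mat:
  "((\<lambda>x. mat_exp (x *\<^sub>R diag_mat d) *v \<sigma>) has_vector_derivative
     diag_mat d *v (mat_exp (x *\<^sub>R diag_mat d) *v \<sigma>)) (at x within T)"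
proof -
  have D: "diag_mat d *v v = (\<chi> i. d i * v $ i)" for v :: "real ^ 'a"
    by (simp add: vec_eq_iff matrix_vector_mult_def diag_mat_def if_distrib[of "\<lambda>y. y * _"] cong: if_cong)
  show ?thesis
    unfolding D mat_exp_diag_mat_mult_vec has_vector_derivative_def
    by (rule iffD2[OF has_derivative_componentwise_within])
      (auto simp: Basis_vec_def inner_axis algebra_simps intro!: derivative_eq_intros)
qed

text \<open>Each coordinate is multiplied by \<open>exp (x * d i)\<close>, which is at most 1.
  Forward orbits therefore stay where \<open>W\<close> and \<open>A\<close> are analytic.\<close>

lemma mat_exp_diag_mat_in_cube:
  assumes "\<sigma> \<in> cube \<delta>" "x \<ge> 0" "\<And>i. d i \<le> 0"
  shows "mat_exp (x *\<^sub>R diag_mat d) *v \<sigma> \<in> cube \<delta>"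
proof -
  have "- \<delta> \<le> exp (x * d i) * \<sigma> $ i \<and> exp (x * d i) * \<sigma> $ i \<le> \<delta>" for i
  proof -
    have "\<bar>exp (x * d i) * \<sigma> $ i\<bar> \<le> 1 * \<bar>\<sigma> $ i\<bar>"
      unfolding abs_mult using assms by (intro mult_right_mono) (auto simp: mult_nonneg_nonpos)
    moreover have "\<bar>\<sigma> $ i\<bar> \<le> \<delta>"
      using assms(1) by (auto simp: cube_def mem_box_cart abs_le_iff minus_le_iff)
    ultimately show ?thesis by linarith
  qed
  then show ?thesis by (simp add: cube_def mem_box_cart mat_exp_diag_mat_mult_vec)
qed

text \<open>Chain rule for \<open>W\<close> along \<open>s\<close>, then the product rule; the
  equation for \<open>M\<close> lets \<open>M x\<close> be factored out on the right. Since
  \<open>S\<close> need not be open, the curve must remain in it.\<close>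

lemma has_vector_derivative_matrix_mult_along_curve:
  fixes W :: "'a::real_normed_vector \<Rightarrow> real ^ 'n ^ 'n" and M A :: "real \<Rightarrow> real ^ 'n ^ 'n"
  assumes W: "W differentiable_on S" and s_in: "\<And>y. y \<in> T \<Longrightarrow> s y \<in> S" and x: "x \<in> T"
    and s: "(s has_vector_derivative s') (at x within T)"
    and M: "(M has_vector_derivative A x ** M x) (at x within T)"
  shows "((\<lambda>x. W (s x) ** M x) has_vector_derivative
     (frechet_derivative W (at (s x) within S) s' + W (s x) ** A x) ** M x) (at x within T)"
proof -
  have "(W has_derivative frechet_derivative W (at (s x) within S)) (at (s x) within S)"
    using W x s_in by (auto simp: differentiable_on_def frechet_derivative_works)
  \<comment> \<open>The chain rule within sets asks for the derivative relative to the image of the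
    curve, a subset of \<open>S\<close>.\<close>
  then have "(W has_derivative frechet_derivative W (at (s x) within S)) (at (s x) within s ` T)"
    by (rule has_derivative_subset) (use s_in in auto)
  from vector_derivative_diff_chain_within[OF s this]
  have "((\<lambda>x. W (s x)) has_vector_derivative frechet_derivative W (at (s x) within S) s') (at x within T)"
    by (simp add: o_def)
  from bounded_bilinear.has_vector_derivative[OF bounded_bilinear_matrix_matrix_mult this M]
  show ?thesis by (simp add: bounded_bilinear.add_left[OF bounded_bilinear_matrix_matrix_mult] matrix_mul_assoc add.commute)
qed

section \<open>Equivalence of the equation on the cube with the differential equations along
  orbits\<close>

theorem lemma2p12:
  fixes G :: "real ^ 'n::{finite,linorder} \<Rightarrow> real ^ 'n::_"
    and Us :: "real ^ 'n::_"
    and \<mu> :: "'n \<Rightarrow> real"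
    and V :: "'n \<Rightarrow> real ^ 'n::_"
    and e :: "'m::{finite,linorder} \<Rightarrow> 'n"
    and \<Omega> :: "real ^ 'm::_ ^ 'm::_"
    and \<delta> :: real
    and P :: "real ^ 'm::_ \<Rightarrow> real ^ 'n::_"
    and A :: "real ^ 'm::_ \<Rightarrow> real ^ 'n::_ ^ 'n::_"
  assumes G_analytic: "G real_analytic_on UNIV"
    and equilibrium: "G Us = 0"
    and eigenvalues_ordered: "strict_mono \<mu>"
    and hyperbolic: "\<And>i. \<mu> i \<noteq> 0"
    and eigenvectors: "\<And>i. V i \<noteq> 0" "\<And>i. jacobian G (at Us) *v V i = \<mu> i *\<^sub>R V i"
    and stable_indices: "strict_mono e" "range e = {i. \<mu> i < 0}"
    and \<Omega>_eq: "\<Omega> = diag_mat (\<lambda>i. \<mu> (e i))"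
    and \<delta>_pos: "\<delta> > 0"
    and P_analytic: "P real_analytic_on cube \<delta>"
    and P_inj: "inj_on P (cube \<delta>)"
    and P_stable: "local_stable_manifold G Us (P ` cube \<delta>)"
    and P_0: "P 0 = Us"
    and P_deriv_0: "jacobian P (at 0) = (\<chi> i j. V (e j) $ i)"
    and P_conj: "\<And>\<sigma> x. \<sigma> \<in> cube \<delta> \<Longrightarrow> x \<ge> 0 \<Longrightarrow>
                   flow_defined G x (P \<sigma>) \<and> flow G x (P \<sigma>) = P (mat_exp (x *\<^sub>R \<Omega>) *v \<sigma>)"
    and A_analytic: "A real_analytic_on cube \<delta>"
    and A_GL: "\<And>\<sigma>. \<sigma> \<in> cube \<delta> \<Longrightarrow> invertible (A \<sigma>)"
  shows
    "(\<exists>W :: real ^ 'm::_ \<Rightarrow> real ^ 'n::_ ^ 'n::_.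
        W real_analytic_on cube \<delta> \<and> (\<forall>\<sigma>\<in>cube \<delta>. invertible (W \<sigma>)) \<and>
        (\<forall>\<sigma>\<in>cube \<delta>.
           jacobian G (at (P \<sigma>)) ** W \<sigma>
             = frechet_derivative W (at \<sigma> within cube \<delta>) (\<Omega> *v \<sigma>) + W \<sigma> ** A \<sigma>))
     \<longleftrightarrow>
     (\<exists>W :: real ^ 'm::_ \<Rightarrow> real ^ 'n::_ ^ 'n::_.
        W real_analytic_on cube \<delta> \<and> (\<forall>\<sigma>\<in>cube \<delta>. invertible (W \<sigma>)) \<and>
        (\<forall>\<sigma>\<in>cube \<delta>. \<forall>Mt :: real \<Rightarrow> real ^ 'n::_ ^ 'n::_.
           Mt 0 = mat 1 \<and>
           (\<forall>x\<ge>0. (Mt has_vector_derivative A (mat_exp (x *\<^sub>R \<Omega>) *v \<sigma>) ** Mt x) (at x within {0..}))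
           \<longrightarrow>
           (let M = (\<lambda>x. W (mat_exp (x *\<^sub>R \<Omega>) *v \<sigma>) ** Mt x) in
              M 0 = W \<sigma> \<and>
              (\<forall>x\<ge>0. (M has_vector_derivative jacobian G (at (P (mat_exp (x *\<^sub>R \<Omega>) *v \<sigma>))) ** M x)
                       (at x within {0..})))))"
proof -
  define s where "s \<sigma> x = mat_exp (x *\<^sub>R \<Omega>) *v \<sigma>" for \<sigma> x
  have s_0: "s \<sigma> 0 = \<sigma>" for \<sigma>
    unfolding s_def \<Omega>_eq mat_exp_diag_mat_mult_vec by (simp add: vec_eq_iff)
  have "\<mu> (e i) < 0" for i using stable_indices(2) by blast
  then have s_in: "s \<sigma> x \<in> cube \<delta>" if "\<sigma> \<in> cube \<delta>" "x \<ge> 0" for \<sigma> x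
    unfolding s_def \<Omega>_eq using that by (intro mat_exp_diag_mat_in_cube) (auto intro: less_imp_le)
  have s_deriv: "(s \<sigma> has_vector_derivative \<Omega> *v s \<sigma> x) (at x within {0..})" for \<sigma> x
    unfolding s_def \<Omega>_eq by (rule has_vector_derivative_mat_exp_diag_mat)
  define lin where "lin \<sigma> Mt \<longleftrightarrow> Mt 0 = mat 1 \<and>
      (\<forall>x\<ge>0. (Mt has_vector_derivative A (s \<sigma> x) ** Mt x) (at x within {0..}))"
    for \<sigma> and Mt :: "real \<Rightarrow> real ^ 'n::_ ^ 'n::_"
  have WM_deriv: "((\<lambda>x. W (s \<sigma> x) ** Mt x) has_vector_derivative
      (frechet_derivative W (at (s \<sigma> x) within cube \<delta>) (\<Omega> *v s \<sigma> x) + W (s \<sigma> x) ** A (s \<sigma> x)) ** Mt x)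
      (at x within {0..})"
    if "W real_analytic_on cube \<delta>" "\<sigma> \<in> cube \<delta>" "x \<ge> 0" "lin \<sigma> Mt"
    for W :: "real ^ 'm::_ \<Rightarrow> real ^ 'n::_ ^ 'n::_" and \<sigma> x Mt
    by (rule has_vector_derivative_matrix_mult_along_curve[where A = "\<lambda>x. A (s \<sigma> x)",
          OF real_analytic_on_imp_differentiable_on[OF that(1)] _ _ s_deriv])
      (use that s_in in \<open>auto simp: lin_def\<close>)
  have lin_ex: "\<exists>Mt. lin \<sigma> Mt" if \<sigma>: "\<sigma> \<in> cube \<delta>" for \<sigma>
  proof -
    have s_cont: "continuous_on {0..} (s \<sigma>)"
      by (rule continuous_on_vector_derivative) (rule s_deriv)
    have A_cont: "continuous_on (cube \<delta>) A"
      using real_analytic_on_imp_differentiable_on[OF A_analytic]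
      by (rule differentiable_imp_continuous_on)
    have "continuous_on {0..} (\<lambda>x. A (s \<sigma> x))"
      by (rule continuous_on_compose2[OF A_cont s_cont]) (use s_in[OF \<sigma>] in blast)
    from linear_ode_global_solution[OF bounded_bilinear_matrix_matrix_mult this, of "mat 1"]
    show ?thesis unfolding lin_def by metis
  qed
  \<comment> \<open>The equivalence holds for each analytic \<open>W\<close> separately, so the same
    \<open>W\<close> is a witness on both sides and invertibility is simply carried along.\<close>
  have pointwise: "(\<forall>\<sigma>\<in>cube \<delta>. jacobian G (at (P \<sigma>)) ** W \<sigma>
          = frechet_derivative W (at \<sigma> within cube \<delta>) (\<Omega> *v \<sigma>) + W \<sigma> ** A \<sigma>)
    \<longleftrightarrow> (\<forall>\<sigma>\<in>cube \<delta>. \<forall>Mt. lin \<sigma> Mt \<longrightarrow> W (s \<sigma> 0) ** Mt 0 = W \<sigma> \<and>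
          (\<forall>x\<ge>0. ((\<lambda>x. W (s \<sigma> x) ** Mt x) has_vector_derivative
             jacobian G (at (P (s \<sigma> x))) ** (W (s \<sigma> x) ** Mt x)) (at x within {0..})))"
    (is "?L \<longleftrightarrow> ?R") if W: "W real_analytic_on cube \<delta>" for W :: "real ^ 'm::_ \<Rightarrow> real ^ 'n::_ ^ 'n::_"
  proof
    assume L: ?L
    show ?R
    proof (intro ballI allI impI conjI)
      fix \<sigma> and Mt :: "real \<Rightarrow> real ^ 'n::_ ^ 'n::_" assume \<sigma>: "\<sigma> \<in> cube \<delta>" and Mt: "lin \<sigma> Mt"
      show "W (s \<sigma> 0) ** Mt 0 = W \<sigma>" using Mt by (simp add: lin_def s_0)
      show "((\<lambda>x. W (s \<sigma> x) ** Mt x) has_vector_derivative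
             jacobian G (at (P (s \<sigma> x))) ** (W (s \<sigma> x) ** Mt x)) (at x within {0..})"
        if "x \<ge> 0" for x
        \<comment> \<open>The identity is applied at the orbit point \<open>s \<sigma> x\<close>,
          which is again in the cube, rather than at \<sigma>.\<close>
        using WM_deriv[OF W \<sigma> that Mt] bspec[OF L s_in[OF \<sigma> that]] by (simp add: matrix_mul_assoc)
    qed
  next
    assume R: ?R
    show ?L
    proof
      fix \<sigma> :: "real ^ 'm::_" assume \<sigma>: "\<sigma> \<in> cube \<delta>"
      obtain Mt where Mt: "lin \<sigma> Mt" using lin_ex[OF \<sigma>] ..
      \<comment> \<open>Both sides are right-hand derivatives at 0 of the same curve, one from the
        product rule and one from the assumed equation.\<close>
      have "(frechet_derivative W (at (s \<sigma> 0) within cube \<delta>) (\<Omega> *v s \<sigma> 0) + W (s \<sigma> 0) ** A (s \<sigma> 0)) ** Mt 0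
          = jacobian G (at (P (s \<sigma> 0))) ** (W (s \<sigma> 0) ** Mt 0)"
      proof (rule vector_derivative_unique_within)
        show "at (0::real) within {0..} \<noteq> bot" by (simp add: at_within_Ici_at_right)
        show "((\<lambda>x. W (s \<sigma> x) ** Mt x) has_vector_derivative
            (frechet_derivative W (at (s \<sigma> 0) within cube \<delta>) (\<Omega> *v s \<sigma> 0) + W (s \<sigma> 0) ** A (s \<sigma> 0)) ** Mt 0)
            (at 0 within {0..})"
          by (rule WM_deriv[OF W \<sigma> order_refl Mt])
        show "((\<lambda>x. W (s \<sigma> x) ** Mt x) has_vector_derivative
            jacobian G (at (P (s \<sigma> 0))) ** (W (s \<sigma> 0) ** Mt 0)) (at 0 within {0..})"
          using R \<sigma> Mt by blast
      qed
      then show "jacobian G (at (P \<sigma>)) ** W \<sigma>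
          = frechet_derivative W (at \<sigma> within cube \<delta>) (\<Omega> *v \<sigma>) + W \<sigma> ** A \<sigma>"
        using Mt by (simp add: lin_def s_0)
    qed
  qed
  show ?thesis
    unfolding Let_def using pointwise[unfolded lin_def s_def]
    by (intro ex_cong1 conj_cong refl)
qed

end
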